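(* Let $X$ be a compact Hausdorff space, let $C(X)$ be the unital $C^{\ast}$-algebra of continuous complex-valued functions on $X$, and let $0<K\leq 1$. Then the following conditions are equivalent: (a) $C(X)$ has weakly infinite bounded rank with respect to $K$; (b) $C(X)$ has weakly infinite real rank; (c) $X$ is weakly infinite-dimensional.
   Context: For a unital $C^{\ast}$-algebra $A$, $A_{sa}$ denotes the set of its self-adjoint elements; $\mathbb{N}=\{1,2,\dots\}$. Weakly infinite real rank: $A$ has weakly infinite real rank if for any sequence $\{x_i : i\in\mathbb{N}\}\subset A_{sa}$ and any $\epsilon>0$ there is a sequence $\{y_i : i\in\mathbb{N}\}\subset A_{sa}$ such that $\|x_i-y_i\|<\epsilon$ for every $i\in\mathbb{N}$ and the element $\sum_{i\in D}y_i^2$ is invertible for some finite set $D\subset\mathbb{N}$ of indices. $K$-unessential tuples and sequences: let $K>0$. An $m$-tuple $(y_1,\dots,y_m)$ of self-adjoint elements of $A$ is $K$-unessential if for every rational $\delta>0$ there is an $m$-tuple $(z_1,\dots,z_m)$ of self-adjoint elements of $A$ such that $\|y_k-z_k\|\leq\delta$ for each $k=1,\dots,m$, the element $\sum_{k=1}^m z_k^2$ is invertible, and $\left\|\left(\sum_{k=1}^m z_k^2\right)^{-1}\right\|\leq \frac{1}{K\delta^2}$. A sequence $\{y_i: i\in\mathbb{N}\}$ of self-adjoint elements of $A$ is $K$-unessential if there is a finite set $D\subset\mathbb{N}$ such that the finite tuple $(y_i)_{i\in D}$ is $K$-unessential. Weakly infinite bounded rank: $A$ has weakly infinite bounded rank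 with respect to $K$ if for any sequence $\{x_i : i\in\mathbb{N}\}\subset A_{sa}$ and any $\epsilon>0$ there is a $K$-unessential sequence $\{y_i: i\in\mathbb{N}\}\subset A_{sa}$ such that $\|x_i-y_i\|<\epsilon$ for every $i\in\mathbb{N}$. Weak infinite-dimensionality: a compact Hausdorff space $X$ is weakly infinite-dimensional if for any sequence $\{(F_i,H_i): i\in\mathbb{N}\}$ of pairs of disjoint closed subsets of $X$ there are partitions $L_i$ between $F_i$ and $H_i$ such that $\bigcap_{i=1}^{\infty}L_i=\emptyset$. Here $L_i\subset X$ is a partition between $F_i$ and $H_i$ if $L_i$ is closed in $X$ and $X\setminus L_i=U_i\cup V_i$ with $U_i,V_i$ disjoint open sets, $F_i\subset U_i$, $H_i\subset V_i$. (In particular, finite-dimensional compacta are included among the weakly infinite-dimensional ones.) *)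

theory Defs
  imports "HOL-Analysis.Analysis" "HOL-Algebra.Module"
begin

section \<open>Unital \<open>C\<^sup>*\<close>-algebras\<close>

definition complex_ring :: "complex ring" where
  "complex_ring = \<lparr>carrier = UNIV, mult = (*), one = 1, zero = 0, add = (+)\<rparr>"

record 'a cstar = "(complex, 'a) module" +
  adj :: "'a \<Rightarrow> 'a"
  cnorm :: "'a \<Rightarrow> real"

text \<open>The zero algebra is allowed; it is the algebra of functions on the empty space.\<close>

locale unital_cstar_algebra = Module.module complex_ring A + ring A
  for A :: "('a, 'b) cstar_scheme" (structure) +
  assumes smult_mult_left:
      "\<lbrakk>x \<in> carrier A; y \<in> carrier A\<rbrakk> \<Longrightarrow> (c \<odot> x) \<otimes> y = c \<odot> (x \<otimes> y)"
    and smult_mult_right: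
      "\<lbrakk>x \<in> carrier A; y \<in> carrier A\<rbrakk> \<Longrightarrow> x \<otimes> (c \<odot> y) = c \<odot> (x \<otimes> y)"
    and adj_closed: "x \<in> carrier A \<Longrightarrow> adj A x \<in> carrier A"
    and adj_adj: "x \<in> carrier A \<Longrightarrow> adj A (adj A x) = x"
    and adj_add: "\<lbrakk>x \<in> carrier A; y \<in> carrier A\<rbrakk> \<Longrightarrow> adj A (x \<oplus> y) = adj A x \<oplus> adj A y"
    and adj_smult: "x \<in> carrier A \<Longrightarrow> adj A (c \<odot> x) = cnj c \<odot> adj A x"
    and adj_mult: "\<lbrakk>x \<in> carrier A; y \<in> carrier A\<rbrakk> \<Longrightarrow> adj A (x \<otimes> y) = adj A y \<otimes> adj A x"
    and cnorm_nonneg: "x \<in> carrier A \<Longrightarrow> 0 \<le> cnorm A x"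
    and cnorm_eq_0_iff: "x \<in> carrier A \<Longrightarrow> cnorm A x = 0 \<longleftrightarrow> x = \<zero>"
    and cnorm_triangle:
      "\<lbrakk>x \<in> carrier A; y \<in> carrier A\<rbrakk> \<Longrightarrow> cnorm A (x \<oplus> y) \<le> cnorm A x + cnorm A y"
    and cnorm_smult: "x \<in> carrier A \<Longrightarrow> cnorm A (c \<odot> x) = cmod c * cnorm A x"
    and cnorm_mult:
      "\<lbrakk>x \<in> carrier A; y \<in> carrier A\<rbrakk> \<Longrightarrow> cnorm A (x \<otimes> y) \<le> cnorm A x * cnorm A y"
    and cstar_identity: "x \<in> carrier A \<Longrightarrow> cnorm A (adj A x \<otimes> x) = (cnorm A x)\<^sup>2"
    and complete:
      "\<lbrakk>\<And>n. s n \<in> carrier A;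
        \<And>\<epsilon>. 0 < \<epsilon> \<Longrightarrow> \<exists>N. \<forall>m\<ge>N. \<forall>n\<ge>N. cnorm A (s m \<ominus> s n) < \<epsilon>\<rbrakk>
       \<Longrightarrow> \<exists>l\<in>carrier A. (\<lambda>n. cnorm A (s n \<ominus> l)) \<longlonglongrightarrow> 0"

definition self_adjoint :: "('a, 'b) cstar_scheme \<Rightarrow> 'a set" where
  "self_adjoint A = {x \<in> carrier A. adj A x = x}"

definition sum_of_squares :: "('a, 'b) cstar_scheme \<Rightarrow> 'i set \<Rightarrow> ('i \<Rightarrow> 'a) \<Rightarrow> 'a" where
  "sum_of_squares A D y = (\<Oplus>\<^bsub>A\<^esub>i\<in>D. y i [^]\<^bsub>A\<^esub> (2::nat))"

section \<open>Weakly infinite real rank and weakly infinite bounded rank\<close>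

text \<open>Sequences are indexed by \<open>nat\<close>, starting at \<open>0\<close> instead of \<open>1\<close>.\<close>

definition weakly_infinite_real_rank :: "('a, 'b) cstar_scheme \<Rightarrow> bool" where
  "weakly_infinite_real_rank A \<longleftrightarrow>
    (\<forall>x :: nat \<Rightarrow> 'a. \<forall>\<epsilon> :: real. (\<forall>i. x i \<in> self_adjoint A) \<and> 0 < \<epsilon> \<longrightarrow>
      (\<exists>y :: nat \<Rightarrow> 'a.
        (\<forall>i. y i \<in> self_adjoint A) \<and>
        (\<forall>i. cnorm A (x i \<ominus>\<^bsub>A\<^esub> y i) < \<epsilon>) \<and>
        (\<exists>D. finite D \<and> sum_of_squares A D y \<in> Units A)))"

text \<open>A finite tuple is a family indexed by a finite set \<open>D\<close>; for an \<open>m\<close>-tuple, \<open>D = {1..m}\<close>.\<close>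

definition unessential_tuple ::
  "('a, 'b) cstar_scheme \<Rightarrow> real \<Rightarrow> 'i set \<Rightarrow> ('i \<Rightarrow> 'a) \<Rightarrow> bool" where
  "unessential_tuple A K D y \<longleftrightarrow>
    (\<forall>\<delta> :: rat. 0 < \<delta> \<longrightarrow>
      (\<exists>z :: 'i \<Rightarrow> 'a.
        (\<forall>i\<in>D. z i \<in> self_adjoint A) \<and>
        (\<forall>i\<in>D. cnorm A (y i \<ominus>\<^bsub>A\<^esub> z i) \<le> of_rat \<delta>) \<and>
        sum_of_squares A D z \<in> Units A \<and>
        cnorm A (m_inv A (sum_of_squares A D z)) \<le> 1 / (K * (of_rat \<delta>)\<^sup>2)))"

definition unessential_sequence ::
  "('a, 'b) cstar_scheme \<Rightarrow> real \<Rightarrow> (nat \<Rightarrow> 'a) \<Rightarrow> bool" where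
  "unessential_sequence A K y \<longleftrightarrow> (\<exists>D. finite D \<and> unessential_tuple A K D y)"

definition weakly_infinite_bounded_rank :: "('a, 'b) cstar_scheme \<Rightarrow> real \<Rightarrow> bool" where
  "weakly_infinite_bounded_rank A K \<longleftrightarrow>
    (\<forall>x :: nat \<Rightarrow> 'a. \<forall>\<epsilon> :: real. (\<forall>i. x i \<in> self_adjoint A) \<and> 0 < \<epsilon> \<longrightarrow>
      (\<exists>y :: nat \<Rightarrow> 'a.
        (\<forall>i. y i \<in> self_adjoint A) \<and>
        unessential_sequence A K y \<and>
        (\<forall>i. cnorm A (x i \<ominus>\<^bsub>A\<^esub> y i) < \<epsilon>)))"

section \<open>Weak infinite-dimensionality\<close>

definition partition_between :: "'a topology \<Rightarrow> 'a set \<Rightarrow> 'a set \<Rightarrow> 'a set \<Rightarrow> bool" where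
  "partition_between X F H L \<longleftrightarrow>
    closedin X L \<and>
    (\<exists>U V. openin X U \<and> openin X V \<and> U \<inter> V = {} \<and> topspace X - L = U \<union> V \<and>
           F \<subseteq> U \<and> H \<subseteq> V)"

definition weakly_infinite_dimensional :: "'a topology \<Rightarrow> bool" where
  "weakly_infinite_dimensional X \<longleftrightarrow>
    (\<forall>F H :: nat \<Rightarrow> 'a set.
      (\<forall>i. closedin X (F i) \<and> closedin X (H i) \<and> F i \<inter> H i = {}) \<longrightarrow>
      (\<exists>L. (\<forall>i. partition_between X (F i) (H i) (L i)) \<and> (\<Inter>i. L i) = {}))"

section \<open>The algebra \<open>C(X)\<close>\<close>

text \<open>
  Functions on \<open>X\<close> are made extensional, so that equality in the carrier is equality on
  \<^term>\<open>topspace X\<close>. The \<open>0\<close> inserted into the supremum only matters for empty \<open>X\<close>.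
\<close>

definition CX :: "'a topology \<Rightarrow> ('a \<Rightarrow> complex) cstar" where
  "CX X = \<lparr>carrier = {f \<in> extensional (topspace X). continuous_map X euclidean f},
     mult = (\<lambda>f g. \<lambda>x\<in>topspace X. f x * g x),
     one = (\<lambda>x\<in>topspace X. 1),
     zero = (\<lambda>x\<in>topspace X. 0),
     add = (\<lambda>f g. \<lambda>x\<in>topspace X. f x + g x),
     smult = (\<lambda>c f. \<lambda>x\<in>topspace X. c * f x),
     adj = (\<lambda>f. \<lambda>x\<in>topspace X. cnj (f x)),
     cnorm = (\<lambda>f. Sup (insert 0 ((\<lambda>x. cmod (f x)) ` topspace X)))\<rparr>"

lemma CX_simps:
  "f \<in> carrier (CX X) \<longleftrightarrow> f \<in> extensional (topspace X) \<and> continuous_map X euclidean f"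
  "f \<otimes>\<^bsub>CX X\<^esub> g = (\<lambda>x\<in>topspace X. f x * g x)"
  "\<one>\<^bsub>CX X\<^esub> = (\<lambda>x\<in>topspace X. 1)"
  "\<zero>\<^bsub>CX X\<^esub> = (\<lambda>x\<in>topspace X. 0)"
  "f \<oplus>\<^bsub>CX X\<^esub> g = (\<lambda>x\<in>topspace X. f x + g x)"
  "c \<odot>\<^bsub>CX X\<^esub> f = (\<lambda>x\<in>topspace X. c * f x)"
  "adj (CX X) f = (\<lambda>x\<in>topspace X. cnj (f x))"
  "cnorm (CX X) f = Sup (insert 0 ((\<lambda>x. cmod (f x)) ` topspace X))"
  by (simp_all add: CX_def)

lemma CX_restrict:
  assumes "continuous_map X euclidean f"
  shows "restrict f (topspace X) \<in> carrier (CX X)"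
proof -
  have "continuous_map X euclidean (restrict f (topspace X))"
    using assms by (rule continuous_map_eq) simp
  then show ?thesis by (simp add: CX_simps)
qed

lemma cring_complex_ring: "cring complex_ring"
proof (intro cringI abelian_groupI comm_monoidI)
  fix x :: complex
  show "\<exists>y\<in>carrier complex_ring. y \<oplus>\<^bsub>complex_ring\<^esub> x = \<zero>\<^bsub>complex_ring\<^esub>"
    by (rule bexI[of _ "- x"]) (auto simp: complex_ring_def)
qed (auto simp: complex_ring_def algebra_simps)

lemma cring_CX: "cring (CX X)"
proof (intro cringI abelian_groupI comm_monoidI)
  fix f assume f: "f \<in> carrier (CX X)"
  show "\<exists>g\<in>carrier (CX X). g \<oplus>\<^bsub>CX X\<^esub> f = \<zero>\<^bsub>CX X\<^esub>"
    using f by (intro bexI[of _ "\<lambda>x\<in>topspace X. - f x"] CX_restrict)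
      (auto simp: CX_simps restrict_def intro!: continuous_map_minus)
  show "\<zero>\<^bsub>CX X\<^esub> \<oplus>\<^bsub>CX X\<^esub> f = f" "\<one>\<^bsub>CX X\<^esub> \<otimes>\<^bsub>CX X\<^esub> f = f"
    using f by (auto simp: CX_simps extensional_def restrict_def fun_eq_iff)
  fix g assume g: "g \<in> carrier (CX X)"
  have "continuous_map X euclidean (\<lambda>x. f x + g x)"
    using f g by (auto simp: CX_simps intro!: continuous_map_add)
  from CX_restrict[OF this] show "f \<oplus>\<^bsub>CX X\<^esub> g \<in> carrier (CX X)"
    by (simp add: CX_simps)
  have "continuous_map X euclidean (\<lambda>x. f x * g x)"
    using f g unfolding CX_simps continuous_map_atin by (auto intro!: tendsto_mult)
  from CX_restrict[OF this] show "f \<otimes>\<^bsub>CX X\<^esub> g \<in> carrier (CX X)"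
    by (simp add: CX_simps)
next
  show "\<zero>\<^bsub>CX X\<^esub> \<in> carrier (CX X)" "\<one>\<^bsub>CX X\<^esub> \<in> carrier (CX X)"
    using CX_restrict[of X "\<lambda>_. 0"] CX_restrict[of X "\<lambda>_. 1"] by (auto simp: CX_simps)
qed (auto simp: CX_simps restrict_def fun_eq_iff algebra_simps)

lemma CX_minus:
  assumes "f \<in> carrier (CX X)" "g \<in> carrier (CX X)"
  shows "f \<ominus>\<^bsub>CX X\<^esub> g = (\<lambda>x\<in>topspace X. f x - g x)"
proof -
  interpret cring "CX X" by (rule cring_CX)
  let ?n = "\<lambda>x\<in>topspace X. - g x"
  have "?n \<in> carrier (CX X)"
    using assms by (intro CX_restrict) (auto simp: CX_simps intro!: continuous_map_minus)
  moreover have "?n \<oplus>\<^bsub>CX X\<^esub> g = \<zero>\<^bsub>CX X\<^esub>"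
    by (auto simp: CX_simps restrict_def)
  ultimately have "\<ominus>\<^bsub>CX X\<^esub> g = ?n"
    using assms(2) by (intro minus_equality) auto
  then show ?thesis
    by (auto simp: a_minus_def CX_simps restrict_def)
qed

lemma bdd_above_CX:
  assumes "compact_space X" "f \<in> carrier (CX X)"
  shows "bdd_above (insert 0 ((\<lambda>x. cmod (f x)) ` topspace X))"
proof -
  have "compact (f ` topspace X)"
    using assms image_compactin[of X "topspace X" euclidean f]
    by (auto simp: CX_simps compact_space_def)
  then have "bounded (f ` topspace X)" by (rule compact_imp_bounded)
  then show ?thesis
    unfolding bdd_above_insert by (auto simp: bounded_iff bdd_above_def)
qed

lemma cmod_le_cnorm_CX:
  assumes "compact_space X" "f \<in> carrier (CX X)" "x \<in> topspace X"
  shows "cmod (f x) \<le> cnorm (CX X) f"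
  unfolding CX_simps using assms by (intro cSup_upper bdd_above_CX) auto

lemma cnorm_CX_le:
  assumes "0 \<le> B" "\<And>x. x \<in> topspace X \<Longrightarrow> cmod (f x) \<le> B"
  shows "cnorm (CX X) f \<le> B"
  unfolding CX_simps using assms by (intro cSup_least) auto

lemma cnorm_CX_nonneg:
  assumes "compact_space X" "f \<in> carrier (CX X)"
  shows "0 \<le> cnorm (CX X) f"
  unfolding CX_simps using assms by (intro cSup_upper bdd_above_CX) auto

lemma CX_complete:
  assumes X: "compact_space X"
    and s: "\<And>n. s n \<in> carrier (CX X)"
    and Cauchy: "\<And>\<epsilon>. 0 < \<epsilon> \<Longrightarrow> \<exists>N. \<forall>m\<ge>N. \<forall>n\<ge>N. cnorm (CX X) (s m \<ominus>\<^bsub>CX X\<^esub> s n) < \<epsilon>"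
  shows "\<exists>l\<in>carrier (CX X). (\<lambda>n. cnorm (CX X) (s n \<ominus>\<^bsub>CX X\<^esub> l)) \<longlonglongrightarrow> 0"
proof -
  interpret cring "CX X" by (rule cring_CX)
  have pt: "\<exists>N. \<forall>m\<ge>N. \<forall>n\<ge>N. \<forall>x\<in>topspace X. cmod (s m x - s n x) < \<epsilon>" if "0 < \<epsilon>" for \<epsilon>
  proof -
    obtain N where N: "\<And>m n. \<lbrakk>m \<ge> N; n \<ge> N\<rbrakk> \<Longrightarrow> cnorm (CX X) (s m \<ominus>\<^bsub>CX X\<^esub> s n) < \<epsilon>"
      using Cauchy[OF \<open>0 < \<epsilon>\<close>] by blast
    have "cmod (s m x - s n x) < \<epsilon>" if "m \<ge> N" "n \<ge> N" "x \<in> topspace X" for m n x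
      using cmod_le_cnorm_CX[OF X minus_closed[OF s s], of x m n] N[of m n] that s
      by (simp add: CX_minus)
    then show ?thesis by blast
  qed
  have "Cauchy (\<lambda>n. s n x)" if "x \<in> topspace X" for x
    unfolding Cauchy_def dist_norm using pt that by blast
  then have "\<exists>l. (\<lambda>n. s n x) \<longlonglongrightarrow> l" if "x \<in> topspace X" for x
    using that Cauchy_convergent_iff convergent_def by blast
  then obtain l where l: "\<And>x. x \<in> topspace X \<Longrightarrow> (\<lambda>n. s n x) \<longlonglongrightarrow> l x" by metis
  have unif: "\<exists>N. \<forall>n\<ge>N. \<forall>x\<in>topspace X. cmod (s n x - l x) \<le> \<epsilon>" if "0 < \<epsilon>" for \<epsilon>
  proof -
    obtain N where N: "\<And>m n x. \<lbrakk>m \<ge> N; n \<ge> N; x \<in> topspace X\<rbrakk> \<Longrightarrow> cmod (s m x - s n x) < \<epsilon>"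
      using pt[OF \<open>0 < \<epsilon>\<close>] by blast
    have "cmod (s n x - l x) \<le> \<epsilon>" if "n \<ge> N" "x \<in> topspace X" for n x
    proof (rule tendsto_upperbound)
      show "(\<lambda>m. cmod (s n x - s m x)) \<longlonglongrightarrow> cmod (s n x - l x)"
        using l[OF that(2)] by (intro tendsto_intros)
      show "\<forall>\<^sub>F m in sequentially. cmod (s n x - s m x) \<le> \<epsilon>"
        using N that by (auto simp: eventually_sequentially intro!: less_imp_le)
    qed simp
    then show ?thesis by blast
  qed
  have "continuous_map X euclidean l"
  proof (rule Met_TC.continuous_map_uniform_limit[where F = sequentially and f = s and g = l,
        simplified])
    show "\<forall>\<^sub>F n in sequentially. continuous_map X euclidean (s n)"
      using s by (auto simp: CX_simps)
    fix \<epsilon> :: real assume "0 < \<epsilon>"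
    then obtain N where N: "\<And>n x. \<lbrakk>n \<ge> N; x \<in> topspace X\<rbrakk> \<Longrightarrow> cmod (s n x - l x) \<le> \<epsilon> / 2"
      using unif[of "\<epsilon> / 2"] by auto
    have "dist (s n x) (l x) < \<epsilon>" if "n \<ge> N" "x \<in> topspace X" for n x
      using N[OF that] \<open>0 < \<epsilon>\<close> unfolding dist_norm by linarith
    then show "\<forall>\<^sub>F n in sequentially. \<forall>x\<in>topspace X. dist (s n x) (l x) < \<epsilon>"
      by (auto simp: eventually_sequentially)
  qed
  then have r: "restrict l (topspace X) \<in> carrier (CX X)" by (rule CX_restrict)
  have "(\<lambda>n. cnorm (CX X) (s n \<ominus>\<^bsub>CX X\<^esub> restrict l (topspace X))) \<longlonglongrightarrow> 0"
  proof (rule LIMSEQ_I)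
    fix \<epsilon> :: real assume "0 < \<epsilon>"
    then obtain N where N: "\<And>n x. \<lbrakk>n \<ge> N; x \<in> topspace X\<rbrakk> \<Longrightarrow> cmod (s n x - l x) \<le> \<epsilon> / 2"
      using unif[of "\<epsilon> / 2"] by auto
    have "cnorm (CX X) (s n \<ominus>\<^bsub>CX X\<^esub> restrict l (topspace X)) \<le> \<epsilon> / 2" if "n \<ge> N" for n
      using N[OF that] \<open>0 < \<epsilon>\<close> by (intro cnorm_CX_le) (auto simp: CX_minus[OF s r])
    then show "\<exists>N. \<forall>n\<ge>N. norm (cnorm (CX X) (s n \<ominus>\<^bsub>CX X\<^esub> restrict l (topspace X)) - 0) < \<epsilon>"
      using cnorm_CX_nonneg[OF X minus_closed[OF s r]] \<open>0 < \<epsilon>\<close>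
      by (intro exI[of _ N]) fastforce
  qed
  with r show ?thesis by blast
qed

lemma module_CX: "Module.module complex_ring (CX X)"
proof (intro Module.moduleI cring_complex_ring)
  show "abelian_group (CX X)"
    by (rule ring.is_abelian_group[OF cring.axioms(1)[OF cring_CX]])
  fix c f assume f: "f \<in> carrier (CX X)"
  have "continuous_map X euclidean (\<lambda>x. c * f x)"
    using f unfolding CX_simps continuous_map_atin by (auto intro!: tendsto_mult)
  from CX_restrict[OF this] show "c \<odot>\<^bsub>CX X\<^esub> f \<in> carrier (CX X)"
    by (simp add: CX_simps)
  show "\<one>\<^bsub>complex_ring\<^esub> \<odot>\<^bsub>CX X\<^esub> f = f"
    using f by (auto simp: CX_simps complex_ring_def extensional_def restrict_def fun_eq_iff)
qed (auto simp: CX_simps complex_ring_def restrict_def fun_eq_iff algebra_simps)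

theorem unital_cstar_algebra_CX:
  assumes X: "compact_space X"
  shows "unital_cstar_algebra (CX X)"
proof -
  interpret cring "CX X" by (rule cring_CX)
  interpret M: Module.module complex_ring "CX X" by (rule module_CX)
  have adj: "adj (CX X) f \<in> carrier (CX X)" if f: "f \<in> carrier (CX X)" for f
  proof -
    have "continuous_map X euclidean (\<lambda>x. cnj (f x))"
      using f unfolding CX_simps continuous_map_atin by (auto intro!: tendsto_cnj)
    from CX_restrict[OF this] show ?thesis by (simp add: CX_simps)
  qed
  note le = cmod_le_cnorm_CX[OF X] and nonneg = cnorm_CX_nonneg[OF X]
  have smult: "c \<odot>\<^bsub>CX X\<^esub> f \<in> carrier (CX X)" if "f \<in> carrier (CX X)" for c f
    using M.smult_closed[of c f] that by (simp add: complex_ring_def)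
  show ?thesis
  proof (intro unital_cstar_algebra.intro module_CX ring_axioms unital_cstar_algebra_axioms.intro)
    fix f assume f: "f \<in> carrier (CX X)"
    show "adj (CX X) f \<in> carrier (CX X)" by (rule adj[OF f])
    show "adj (CX X) (adj (CX X) f) = f"
      using f by (auto simp: CX_simps extensional_def restrict_def fun_eq_iff)
    show "0 \<le> cnorm (CX X) f" by (rule nonneg[OF f])
    show "cnorm (CX X) f = 0 \<longleftrightarrow> f = \<zero>\<^bsub>CX X\<^esub>"
    proof
      assume "cnorm (CX X) f = 0"
      then have "f x = 0" if "x \<in> topspace X" for x using le[OF f that] by simp
      then show "f = \<zero>\<^bsub>CX X\<^esub>"
        using f by (auto simp: CX_simps extensional_def restrict_def fun_eq_iff)
    next
      assume "f = \<zero>\<^bsub>CX X\<^esub>"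
      then have "cnorm (CX X) f \<le> 0" by (intro cnorm_CX_le) (auto simp: CX_simps)
      then show "cnorm (CX X) f = 0" using nonneg[OF f] by simp
    qed
    show "cnorm (CX X) (adj (CX X) f \<otimes>\<^bsub>CX X\<^esub> f) = (cnorm (CX X) f)\<^sup>2" (is "?l = _")
    proof (rule antisym)
      show "?l \<le> (cnorm (CX X) f)\<^sup>2"
        using le[OF f]
        by (intro cnorm_CX_le)
          (auto simp: CX_simps(2,7) norm_mult simp flip: power2_eq_square intro!: power_mono)
      have c: "adj (CX X) f \<otimes>\<^bsub>CX X\<^esub> f \<in> carrier (CX X)" using adj[OF f] f by simp
      have "cnorm (CX X) f \<le> sqrt ?l"
      proof (rule cnorm_CX_le)
        show "0 \<le> sqrt ?l" using nonneg[OF c] by simp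
        fix x assume x: "x \<in> topspace X"
        have "(cmod (f x))\<^sup>2 \<le> ?l"
          using le[OF c x] x by (simp add: CX_simps(2,7) norm_mult power2_eq_square)
        then show "cmod (f x) \<le> sqrt ?l" by (rule real_le_rsqrt)
      qed
      then show "(cnorm (CX X) f)\<^sup>2 \<le> ?l"
        using nonneg[OF f] nonneg[OF c] by (metis power_mono real_sqrt_pow2)
    qed
    fix c
    show "adj (CX X) (c \<odot>\<^bsub>CX X\<^esub> f) = cnj c \<odot>\<^bsub>CX X\<^esub> adj (CX X) f"
      by (auto simp: CX_simps restrict_def)
    show "cnorm (CX X) (c \<odot>\<^bsub>CX X\<^esub> f) = cmod c * cnorm (CX X) f" (is "?l = ?r")
    proof (rule antisym)
      show "?l \<le> ?r"
        using le[OF f] nonneg[OF f]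
        by (intro cnorm_CX_le) (auto simp: CX_simps(6) norm_mult intro!: mult_left_mono)
      show "?r \<le> ?l"
      proof (cases "c = 0")
        case True then show ?thesis using nonneg[OF smult[OF f]] by simp
      next
        case False
        have "cnorm (CX X) f \<le> ?l / cmod c"
        proof (rule cnorm_CX_le)
          show "0 \<le> ?l / cmod c" using nonneg[OF smult[OF f]] by simp
          fix x assume x: "x \<in> topspace X"
          show "cmod (f x) \<le> ?l / cmod c"
            using le[OF smult[OF f] x, of c] x False
            by (simp add: CX_simps(6) norm_mult field_simps)
        qed
        then show ?thesis using False by (simp add: field_simps)
      qed
    qed
    fix g assume g: "g \<in> carrier (CX X)"
    show "(c \<odot>\<^bsub>CX X\<^esub> f) \<otimes>\<^bsub>CX X\<^esub> g = c \<odot>\<^bsub>CX X\<^esub> (f \<otimes>\<^bsub>CX X\<^esub> g)"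
      and "f \<otimes>\<^bsub>CX X\<^esub> (c \<odot>\<^bsub>CX X\<^esub> g) = c \<odot>\<^bsub>CX X\<^esub> (f \<otimes>\<^bsub>CX X\<^esub> g)"
      and "adj (CX X) (f \<oplus>\<^bsub>CX X\<^esub> g) = adj (CX X) f \<oplus>\<^bsub>CX X\<^esub> adj (CX X) g"
      and "adj (CX X) (f \<otimes>\<^bsub>CX X\<^esub> g) = adj (CX X) g \<otimes>\<^bsub>CX X\<^esub> adj (CX X) f"
      by (auto simp: CX_simps restrict_def fun_eq_iff)
    show "cnorm (CX X) (f \<oplus>\<^bsub>CX X\<^esub> g) \<le> cnorm (CX X) f + cnorm (CX X) g"
      using le[OF f] le[OF g] nonneg[OF f] nonneg[OF g]
      by (intro cnorm_CX_le) (auto simp: CX_simps(5) intro!: norm_triangle_le add_mono)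
    show "cnorm (CX X) (f \<otimes>\<^bsub>CX X\<^esub> g) \<le> cnorm (CX X) f * cnorm (CX X) g"
      using le[OF f] le[OF g] nonneg[OF f] nonneg[OF g]
      by (intro cnorm_CX_le) (auto simp: CX_simps(2) norm_mult intro!: mult_mono)
  qed (rule CX_complete[OF X])
qed

end

theory Submission
  imports Defs
begin

text \<open>
  Real and bounded rank: a nowhere vanishing tuple \<open>y\<close> of real functions can be pushed away from
  the origin radially, \<open>z = y (1 + \<delta> / \<bar>y\<bar>)\<close>, which moves every coordinate by at most \<open>\<delta>\<close> and makes
  \<open>\<bar>z\<bar> \<ge> \<delta>\<close>; hence such tuples are automatically \<open>K\<close>-unessential for all \<open>K \<le> 1\<close>.

  Real rank and dimension: zero sets of perturbed Urysohn functions are partitions. Conversely,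
  partitions with empty intersection yield a cover of \<open>X\<close> by finitely many complements
  \<open>U\<^sub>i \<union> V\<^sub>i\<close>, which shrinks to a closed cover \<open>C\<^sub>i\<close>; a function separating
  \<open>C\<^sub>i \<inter> U\<^sub>i\<close> from \<open>C\<^sub>i \<inter> V\<^sub>i\<close> replaces the small values of \<open>x\<^sub>i\<close>.
\<close>

section \<open>Real functions as self-adjoint elements of \<open>C(X)\<close>\<close>

text \<open>Restricting to \<open>topspace X\<close> makes the element extensional, as
  \<open>carrier (CX X)\<close> demands. Continuity stays outside as a hypothesis, so formulas in
  \<open>p\<close> can be passed in directly.\<close>

definition of_real_CX :: "'a topology \<Rightarrow> ('a \<Rightarrow> real) \<Rightarrow> 'a \<Rightarrow> complex" where
  "of_real_CX X g = (\<lambda>p\<in>topspace X. complex_of_real (g p))"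

lemma of_real_CX_self_adjoint:
  assumes "continuous_map X euclideanreal g"
  shows "of_real_CX X g \<in> self_adjoint (CX X)"
proof -
  have "continuous_map X euclidean (\<lambda>p. complex_of_real (g p))"
    using assms unfolding continuous_map_atin by (auto intro!: tendsto_of_real)
  from CX_restrict[OF this] show ?thesis
    by (auto simp: self_adjoint_def of_real_CX_def CX_simps(7) restrict_def)
qed

text \<open>Self-adjointness gives \<open>cnj (f p) = f p\<close>, so the real part of
  \<open>f\<close> is the witness; extensionality of \<open>f\<close> upgrades agreement on
  \<open>topspace X\<close> to equality.\<close>

lemma self_adjoint_CX_cases:
  assumes "f \<in> self_adjoint (CX X)"
  obtains g where "continuous_map X euclideanreal g" "f = of_real_CX X g"
proof
  have f: "f \<in> extensional (topspace X)" "continuous_map X euclidean f"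
    and adj: "(\<lambda>p\<in>topspace X. cnj (f p)) = f"
    using assms by (auto simp: self_adjoint_def CX_simps)
  show "continuous_map X euclideanreal (\<lambda>p. Re (f p))"
    using f(2) unfolding continuous_map_atin by (auto intro!: tendsto_Re)
  have "complex_of_real (Re (f p)) = f p" if "p \<in> topspace X" for p
    using fun_cong[OF adj, of p] that by (simp add: complex_eq_iff)
  then show "f = of_real_CX X (\<lambda>p. Re (f p))"
    using f(1) by (auto simp: of_real_CX_def extensional_def restrict_def)
qed

lemma self_adjoint_CX_seq:
  assumes "\<And>i. f i \<in> self_adjoint (CX X)"
  shows "\<exists>g. (\<forall>i. continuous_map X euclideanreal (g i)) \<and> f = (\<lambda>i. of_real_CX X (g i))"
proof -
  have "\<exists>g. continuous_map X euclideanreal g \<and> f i = of_real_CX X g" for i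
    using self_adjoint_CX_cases[OF assms[of i]] by blast
  then obtain g where "\<forall>i. continuous_map X euclideanreal (g i) \<and> f i = of_real_CX X (g i)"
    by metis
  then show ?thesis by (intro exI[of _ g]) auto
qed

lemma of_real_CX_carrier:
  "continuous_map X euclideanreal g \<Longrightarrow> of_real_CX X g \<in> carrier (CX X)"
  using of_real_CX_self_adjoint by (force simp: self_adjoint_def)

lemma of_real_CX_minus:
  assumes "continuous_map X euclideanreal f" "continuous_map X euclideanreal g"
  shows "of_real_CX X f \<ominus>\<^bsub>CX X\<^esub> of_real_CX X g = of_real_CX X (\<lambda>p. f p - g p)"
  using assms by (simp add: CX_minus of_real_CX_carrier)
    (auto simp: of_real_CX_def restrict_def)

lemma cnorm_of_real_CX_le:
  assumes "0 \<le> B" "\<And>p. p \<in> topspace X \<Longrightarrow> \<bar>g p\<bar> \<le> B"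
  shows "cnorm (CX X) (of_real_CX X g) \<le> B"
  using assms by (intro cnorm_CX_le) (auto simp: of_real_CX_def)

lemma abs_le_cnorm_of_real_CX:
  assumes "compact_space X" "continuous_map X euclideanreal g" "p \<in> topspace X"
  shows "\<bar>g p\<bar> \<le> cnorm (CX X) (of_real_CX X g)"
  using cmod_le_cnorm_CX[OF assms(1) of_real_CX_carrier[OF assms(2)] assms(3)] assms(3)
  by (simp add: of_real_CX_def)

section \<open>Sums of squares and invertibility in C(X)\<close>

lemma sum_of_squares_of_real_CX:
  assumes "finite D" "\<And>i. i \<in> D \<Longrightarrow> continuous_map X euclideanreal (y i)"
  shows "sum_of_squares (CX X) D (\<lambda>i. of_real_CX X (y i)) = of_real_CX X (\<lambda>p. \<Sum>i\<in>D. (y i p)\<^sup>2)"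
proof -
  interpret cring "CX X" by (rule cring_CX)
  show ?thesis
    using assms unfolding sum_of_squares_def
  proof (induction D)
    case empty
    then show ?case by (simp add: of_real_CX_def CX_simps(4))
  next
    case (insert i D)
    \<comment> \<open>\<open>numeral_2_eq_2\<close> turns the exponent into successors, so the ring
      power unfolds into products that can be evaluated pointwise.\<close>
    then show ?case
      by (simp add: Pi_def of_real_CX_carrier numeral_2_eq_2)
        (auto simp: of_real_CX_def CX_simps(2,3,5) restrict_def fun_eq_iff)
  qed
qed

lemma Units_CX_nonzero:
  assumes "f \<in> Units (CX X)" "p \<in> topspace X"
  shows "f p \<noteq> 0"
proof -
  obtain g where "f \<otimes>\<^bsub>CX X\<^esub> g = \<one>\<^bsub>CX X\<^esub>"
    using assms(1) by (auto simp: Units_def)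
  from fun_cong[OF this, of p] show ?thesis using assms(2) by (auto simp: CX_simps)
qed

text \<open>Without zeros the pointwise reciprocal is continuous, and by commutativity a one-sided
  inverse suffices. The norm bound for unessential tuples is read off from this explicit
  inverse.\<close>

lemma of_real_CX_inverse:
  assumes g: "continuous_map X euclideanreal g" and nz: "\<And>p. p \<in> topspace X \<Longrightarrow> g p \<noteq> 0"
  shows "of_real_CX X g \<in> Units (CX X)"
    and "inv\<^bsub>CX X\<^esub> (of_real_CX X g) = of_real_CX X (\<lambda>p. inverse (g p))"
proof -
  interpret cring "CX X" by (rule cring_CX)
  let ?h = "of_real_CX X (\<lambda>p. inverse (g p))"
  have h: "?h \<in> carrier (CX X)"
    using g nz by (intro of_real_CX_carrier continuous_map_real_inverse) auto
  have mult: "of_real_CX X g \<otimes>\<^bsub>CX X\<^esub> ?h = \<one>\<^bsub>CX X\<^esub>"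
    using nz by (auto simp: CX_simps(2,3) of_real_CX_def restrict_def fun_eq_iff)
  show "of_real_CX X g \<in> Units (CX X)"
    using mult h of_real_CX_carrier[OF g] m_comm[OF h of_real_CX_carrier[OF g]]
    by (auto simp: Units_def)
  show "inv\<^bsub>CX X\<^esub> (of_real_CX X g) = ?h"
    using comm_inv_char[OF of_real_CX_carrier[OF g] h mult] .
qed

text \<open>A sum of real squares vanishes at a point only if every term does, so invertibility
  means having no common zero.\<close>

lemma sum_of_squares_of_real_CX_in_Units_iff:
  assumes "finite D" "\<And>i. i \<in> D \<Longrightarrow> continuous_map X euclideanreal (y i)"
  shows "sum_of_squares (CX X) D (\<lambda>i. of_real_CX X (y i)) \<in> Units (CX X) \<longleftrightarrow>
    (\<forall>p\<in>topspace X. \<exists>i\<in>D. y i p \<noteq> 0)"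
proof -
  have sum: "(\<Sum>i\<in>D. (y i p)\<^sup>2) = 0 \<longleftrightarrow> (\<forall>i\<in>D. y i p = 0)" for p
    using assms(1) by (simp add: sum_nonneg_eq_0_iff)
  have c: "continuous_map X euclideanreal (\<lambda>p. \<Sum>i\<in>D. (y i p)\<^sup>2)"
    using assms by (intro continuous_intros) auto
  have eq: "sum_of_squares (CX X) D (\<lambda>i. of_real_CX X (y i)) = of_real_CX X (\<lambda>p. \<Sum>i\<in>D. (y i p)\<^sup>2)"
    by (rule sum_of_squares_of_real_CX[OF assms])
  show ?thesis
    unfolding eq
  proof
    assume "of_real_CX X (\<lambda>p. \<Sum>i\<in>D. (y i p)\<^sup>2) \<in> Units (CX X)"
    from Units_CX_nonzero[OF this] show "\<forall>p\<in>topspace X. \<exists>i\<in>D. y i p \<noteq> 0"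
      using sum by (simp add: of_real_CX_def del: of_real_sum of_real_power)
  next
    assume "\<forall>p\<in>topspace X. \<exists>i\<in>D. y i p \<noteq> 0"
    then show "of_real_CX X (\<lambda>p. \<Sum>i\<in>D. (y i p)\<^sup>2) \<in> Units (CX X)"
      using sum by (intro of_real_CX_inverse(1)[OF c]) auto
  qed
qed

text \<open>Both directions of the dimension argument use real rank in this form. The pointwise
  bound is non-strict; as it is asked for every \<epsilon>, it matches the strict norm
  bound.\<close>

lemma weakly_infinite_real_rank_CX_iff:
  assumes X: "compact_space X"
  shows "weakly_infinite_real_rank (CX X) \<longleftrightarrow>
    (\<forall>x \<epsilon>. (\<forall>i::nat. continuous_map X euclideanreal (x i)) \<and> 0 < \<epsilon> \<longrightarrow>
      (\<exists>y D. (\<forall>i. continuous_map X euclideanreal (y i)) \<and>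
         (\<forall>i. \<forall>p\<in>topspace X. \<bar>x i p - y i p\<bar> \<le> \<epsilon>) \<and>
         finite D \<and> (\<forall>p\<in>topspace X. \<exists>i\<in>D. y i p \<noteq> 0)))"
    (is "?L \<longleftrightarrow> ?R")
proof
  assume L: ?L
  show ?R
  proof (intro allI impI, elim conjE)
    fix x and \<epsilon> :: real
    assume x: "\<forall>i::nat. continuous_map X euclideanreal (x i)" and \<epsilon>: "0 < \<epsilon>"
    obtain y' D where y': "\<And>i. y' i \<in> self_adjoint (CX X)"
        "\<And>i. cnorm (CX X) (of_real_CX X (x i) \<ominus>\<^bsub>CX X\<^esub> y' i) < \<epsilon>"
      and D: "finite D" "sum_of_squares (CX X) D y' \<in> Units (CX X)"
      using L[unfolded weakly_infinite_real_rank_def, rule_format,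
          of "\<lambda>i. of_real_CX X (x i)" \<epsilon>] x \<epsilon> of_real_CX_self_adjoint by blast
    obtain y where y: "\<And>i. continuous_map X euclideanreal (y i)"
      and y'_eq: "y' = (\<lambda>i. of_real_CX X (y i))"
      using self_adjoint_CX_seq[of y' X] y'(1) by blast
    have "\<bar>x i p - y i p\<bar> \<le> \<epsilon>" if "p \<in> topspace X" for i p
      using y'(2)[of i] x y
        abs_le_cnorm_of_real_CX[OF X continuous_map_diff[OF x[rule_format, of i] y[of i]] that]
      by (simp add: y'_eq of_real_CX_minus)
    then show "\<exists>y D. (\<forall>i. continuous_map X euclideanreal (y i)) \<and>
         (\<forall>i. \<forall>p\<in>topspace X. \<bar>x i p - y i p\<bar> \<le> \<epsilon>) \<and>
         finite D \<and> (\<forall>p\<in>topspace X. \<exists>i\<in>D. y i p \<noteq> 0)"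
      using y D sum_of_squares_of_real_CX_in_Units_iff[of D X y] unfolding y'_eq by blast
  qed
next
  assume R: ?R
  show ?L
    unfolding weakly_infinite_real_rank_def
  proof (intro allI impI, elim conjE)
    fix x' and \<epsilon> :: real
    assume x': "\<forall>i::nat. x' i \<in> self_adjoint (CX X)" and \<epsilon>: "0 < \<epsilon>"
    obtain x where x: "\<And>i. continuous_map X euclideanreal (x i)"
      and x'_eq: "x' = (\<lambda>i. of_real_CX X (x i))"
      using self_adjoint_CX_seq[of x' X] x' by blast
    \<comment> \<open>Halving restores strictness: a pointwise bound \<epsilon>/2 gives norm at most
      \<epsilon>/2, hence below \<epsilon>.\<close>
    obtain y D where y: "\<And>i. continuous_map X euclideanreal (y i)"
        "\<And>i p. p \<in> topspace X \<Longrightarrow> \<bar>x i p - y i p\<bar> \<le> \<epsilon> / 2"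
      and D: "finite D" "\<forall>p\<in>topspace X. \<exists>i\<in>D. y i p \<noteq> 0"
      using R[rule_format, of x "\<epsilon> / 2"] x half_gt_zero[OF \<epsilon>] by blast
    have "cnorm (CX X) (x' i \<ominus>\<^bsub>CX X\<^esub> of_real_CX X (y i)) < \<epsilon>" for i
      using cnorm_of_real_CX_le[of "\<epsilon> / 2" X "\<lambda>p. x i p - y i p"] y x \<epsilon>
      by (simp add: x'_eq of_real_CX_minus)
    then show "\<exists>y. (\<forall>i. y i \<in> self_adjoint (CX X)) \<and>
        (\<forall>i. cnorm (CX X) (x' i \<ominus>\<^bsub>CX X\<^esub> y i) < \<epsilon>) \<and>
        (\<exists>D. finite D \<and> sum_of_squares (CX X) D y \<in> Units (CX X))"
      using y(1) D sum_of_squares_of_real_CX_in_Units_iff[of D X y]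
      by (intro exI[of _ "\<lambda>i. of_real_CX X (y i)"]) (auto intro: of_real_CX_self_adjoint)
  qed
qed

section \<open>Bounded rank\<close>

lemma (in unital_cstar_algebra) cnorm_minus_triangle:
  assumes "x \<in> carrier A" "y \<in> carrier A" "z \<in> carrier A"
  shows "cnorm A (x \<ominus> z) \<le> cnorm A (x \<ominus> y) + cnorm A (y \<ominus> z)"
proof -
  have "x \<ominus> z = (x \<ominus> y) \<oplus> (y \<ominus> z)"
    using assms by (simp add: minus_eq a_assoc r_neg1)
  then show ?thesis using assms cnorm_triangle[of "x \<ominus> y" "y \<ominus> z"] by simp
qed

text \<open>An unessential tuple lies within any rational \<delta> > 0 of one with invertible sum of
  squares. Half of \<epsilon> is spent on reaching \<open>y\<close>, the other half on moving on to
  \<open>z\<close>.\<close>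

lemma bounded_rank_imp_real_rank:
  assumes "unital_cstar_algebra A" "weakly_infinite_bounded_rank A K"
  shows "weakly_infinite_real_rank A"
  unfolding weakly_infinite_real_rank_def
proof (intro allI impI, elim conjE)
  interpret unital_cstar_algebra A by fact
  fix x :: "nat \<Rightarrow> 'a" and \<epsilon> :: real
  assume x: "\<forall>i. x i \<in> self_adjoint A" and \<epsilon>: "0 < \<epsilon>"
  obtain y D where y: "\<And>i. y i \<in> self_adjoint A"
      "\<And>i. cnorm A (x i \<ominus>\<^bsub>A\<^esub> y i) < \<epsilon> / 2"
    and D: "finite D" "unessential_tuple A K D y"
    using assms(2)[unfolded weakly_infinite_bounded_rank_def, rule_format, of x "\<epsilon> / 2"] x \<epsilon>
    unfolding unessential_sequence_def by auto
  obtain \<delta> :: rat where \<delta>: "0 < real_of_rat \<delta>" "real_of_rat \<delta> < \<epsilon> / 2"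
    using of_rat_dense[of 0 "\<epsilon> / 2"] \<epsilon> by auto
  obtain z where z: "\<And>i. i \<in> D \<Longrightarrow> z i \<in> self_adjoint A"
      "\<And>i. i \<in> D \<Longrightarrow> cnorm A (y i \<ominus>\<^bsub>A\<^esub> z i) \<le> of_rat \<delta>"
      "sum_of_squares A D z \<in> Units A"
    using D(2)[unfolded unessential_tuple_def, rule_format, of \<delta>] \<delta>(1) by auto
  have c: "\<And>i. x i \<in> carrier A" "\<And>i. y i \<in> carrier A" "\<And>i. i \<in> D \<Longrightarrow> z i \<in> carrier A"
    using x y(1) z(1) by (auto simp: self_adjoint_def)
  \<comment> \<open>\<open>z\<close> is controlled only on \<open>D\<close>; keeping
    \<open>y\<close> elsewhere gives a full sequence without changing the sum over
    \<open>D\<close>.\<close>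
  define w where "w i = (if i \<in> D then z i else y i)" for i
  have "cnorm A (x i \<ominus>\<^bsub>A\<^esub> w i) < \<epsilon>" for i
  proof (cases "i \<in> D")
    case True
    then show ?thesis
      using cnorm_minus_triangle[of "x i" "y i" "z i"] c y(2)[of i] z(2)[of i] \<delta>(2)
      by (simp add: w_def)
  next
    case False
    then show ?thesis using y(2)[of i] \<epsilon> by (simp add: w_def)
  qed
  moreover have "sum_of_squares A D w = sum_of_squares A D z"
    unfolding sum_of_squares_def using c by (intro finsum_cong') (auto simp: w_def)
  ultimately show "\<exists>y. (\<forall>i. y i \<in> self_adjoint A) \<and>
        (\<forall>i. cnorm A (x i \<ominus>\<^bsub>A\<^esub> y i) < \<epsilon>) \<and>
        (\<exists>D. finite D \<and> sum_of_squares A D y \<in> Units A)"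
    using y(1) z(1,3) D(1) by (intro exI[of _ w]) (auto simp: w_def)
qed

text \<open>After the radial push the squares sum to \<open>(r p + \<delta>)\<^sup>2\<close>, which
  is at least \<open>\<delta>\<^sup>2\<close> and so, by \<open>K \<le> 1\<close>, at least
  \<open>K * \<delta>\<^sup>2\<close>. Taking reciprocals gives the bound on the inverse.\<close>

lemma unessential_tuple_CX:
  assumes X: "compact_space X" and K: "0 < K" "K \<le> 1" and D: "finite D"
    and y: "\<And>i. i \<in> D \<Longrightarrow> continuous_map X euclideanreal (y i)"
    and nz: "\<And>p. p \<in> topspace X \<Longrightarrow> \<exists>i\<in>D. y i p \<noteq> 0"
  shows "unessential_tuple (CX X) K D (\<lambda>i. of_real_CX X (y i))"
  unfolding unessential_tuple_def
proof (intro allI impI)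
  fix \<delta>' :: rat assume "0 < \<delta>'"
  define \<delta> where "\<delta> = real_of_rat \<delta>'"
  have \<delta>: "0 < \<delta>" using \<open>0 < \<delta>'\<close> by (simp add: \<delta>_def)
  define r where "r p = sqrt (\<Sum>i\<in>D. (y i p)\<^sup>2)" for p
  have r_pos: "0 < r p" if "p \<in> topspace X" for p
  proof -
    obtain i where i: "i \<in> D" "y i p \<noteq> 0" using nz[OF \<open>p \<in> topspace X\<close>] by blast
    show ?thesis unfolding r_def using D i by (auto intro!: sum_pos2[of D i])
  qed
  have r_cont: "continuous_map X euclideanreal r"
    unfolding r_def using y D by (intro continuous_intros) auto
  have y_le: "\<bar>y i p\<bar> \<le> r p" if "i \<in> D" for i p
    unfolding r_def using D that by (intro real_le_rsqrt) (auto intro: member_le_sum)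
  \<comment> \<open>The vector of values at \<open>p\<close> has length \<open>r p\<close>; this
    factor lengthens it by exactly \<delta> in its own direction.\<close>
  define z where "z i p = y i p * (1 + \<delta> / r p)" for i p
  have z_cont: "continuous_map X euclideanreal (z i)" if "i \<in> D" for i
    unfolding z_def using y that r_cont r_pos
    by (intro continuous_intros) (auto simp: less_imp_neq[symmetric])
  have diff: "\<bar>y i p - z i p\<bar> \<le> \<delta>" if "i \<in> D" "p \<in> topspace X" for i p
  proof -
    have "\<bar>y i p - z i p\<bar> = \<delta> * (\<bar>y i p\<bar> / r p)"
      using r_pos[OF that(2)] \<delta> by (simp add: z_def algebra_simps abs_mult)
    also have "\<dots> \<le> \<delta> * 1"
      using y_le[OF that(1), of p] r_pos[OF that(2)] \<delta> by (intro mult_left_mono) auto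
    finally show ?thesis by simp
  qed
  have sum: "(\<Sum>i\<in>D. (z i p)\<^sup>2) = (r p + \<delta>)\<^sup>2" if "p \<in> topspace X" for p
  proof -
    have "(\<Sum>i\<in>D. (z i p)\<^sup>2) = (r p)\<^sup>2 * (1 + \<delta> / r p)\<^sup>2"
      by (simp add: z_def r_def power_mult_distrib sum_distrib_right sum_nonneg)
    also have "\<dots> = (r p + \<delta>)\<^sup>2"
      using r_pos[OF that] by (simp flip: power_mult_distrib add: field_simps)
    finally show ?thesis .
  qed
  have lower: "K * \<delta>\<^sup>2 \<le> (\<Sum>i\<in>D. (z i p)\<^sup>2)" if "p \<in> topspace X" for p
  proof -
    have "K * \<delta>\<^sup>2 \<le> 1 * \<delta>\<^sup>2" using K by (intro mult_right_mono) auto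
    also have "\<dots> \<le> (r p + \<delta>)\<^sup>2" using \<delta> r_pos[OF that] by (auto intro!: power_mono)
    finally show ?thesis by (simp add: sum[OF that])
  qed
  have K\<delta>: "0 < K * \<delta>\<^sup>2" using K \<delta> by simp
  have sum_cont: "continuous_map X euclideanreal (\<lambda>p. \<Sum>i\<in>D. (z i p)\<^sup>2)"
    using z_cont D by (intro continuous_intros) auto
  have sum_nz: "(\<Sum>i\<in>D. (z i p)\<^sup>2) \<noteq> 0" if "p \<in> topspace X" for p
    using lower[OF that] K\<delta> by linarith
  have sq: "sum_of_squares (CX X) D (\<lambda>i. of_real_CX X (z i)) = of_real_CX X (\<lambda>p. \<Sum>i\<in>D. (z i p)\<^sup>2)"
    by (rule sum_of_squares_of_real_CX[OF D z_cont])
  have inv_sq: "inv\<^bsub>CX X\<^esub> (of_real_CX X (\<lambda>p. \<Sum>i\<in>D. (z i p)\<^sup>2)) =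
      of_real_CX X (\<lambda>p. inverse (\<Sum>i\<in>D. (z i p)\<^sup>2))"
    by (rule of_real_CX_inverse(2)[OF sum_cont sum_nz])
  show "\<exists>z. (\<forall>i\<in>D. z i \<in> self_adjoint (CX X)) \<and>
      (\<forall>i\<in>D. cnorm (CX X) (of_real_CX X (y i) \<ominus>\<^bsub>CX X\<^esub> z i) \<le> real_of_rat \<delta>') \<and>
      sum_of_squares (CX X) D z \<in> Units (CX X) \<and>
      cnorm (CX X) (inv\<^bsub>CX X\<^esub> sum_of_squares (CX X) D z) \<le> 1 / (K * (real_of_rat \<delta>')\<^sup>2)"
    unfolding \<delta>_def[symmetric]
  proof (intro exI[of _ "\<lambda>i. of_real_CX X (z i)"] conjI ballI)
    fix i assume i: "i \<in> D"
    show "of_real_CX X (z i) \<in> self_adjoint (CX X)"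
      by (rule of_real_CX_self_adjoint[OF z_cont[OF i]])
    show "cnorm (CX X) (of_real_CX X (y i) \<ominus>\<^bsub>CX X\<^esub> of_real_CX X (z i)) \<le> \<delta>"
      unfolding of_real_CX_minus[OF y[OF i] z_cont[OF i]]
      using \<delta> diff[OF i] by (intro cnorm_of_real_CX_le) auto
  next
    show "sum_of_squares (CX X) D (\<lambda>i. of_real_CX X (z i)) \<in> Units (CX X)"
      unfolding sq by (rule of_real_CX_inverse(1)[OF sum_cont sum_nz])
    show "cnorm (CX X) (inv\<^bsub>CX X\<^esub> sum_of_squares (CX X) D (\<lambda>i. of_real_CX X (z i)))
        \<le> 1 / (K * \<delta>\<^sup>2)"
      unfolding sq inv_sq
    proof (rule cnorm_of_real_CX_le)
      fix p assume p: "p \<in> topspace X"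
      show "\<bar>inverse (\<Sum>i\<in>D. (z i p)\<^sup>2)\<bar> \<le> 1 / (K * \<delta>\<^sup>2)"
        using le_imp_inverse_le[OF lower[OF p] K\<delta>] by (simp add: sum_nonneg inverse_eq_divide)
    qed (use K\<delta> in simp)
  qed
qed

text \<open>The approximating sequence supplied by real rank serves unchanged, since its finite
  subfamily without common zero is unessential.\<close>

lemma real_rank_imp_bounded_rank_CX:
  assumes X: "compact_space X" and K: "0 < K" "K \<le> 1"
    and rank: "weakly_infinite_real_rank (CX X)"
  shows "weakly_infinite_bounded_rank (CX X) K"
  unfolding weakly_infinite_bounded_rank_def
proof (intro allI impI, elim conjE)
  fix x :: "nat \<Rightarrow> 'a \<Rightarrow> complex" and \<epsilon> :: real
  assume "\<forall>i. x i \<in> self_adjoint (CX X)" "0 < \<epsilon>"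
  then obtain y' D where y': "\<And>i. y' i \<in> self_adjoint (CX X)"
      "\<And>i. cnorm (CX X) (x i \<ominus>\<^bsub>CX X\<^esub> y' i) < \<epsilon>"
    and D: "finite D" "sum_of_squares (CX X) D y' \<in> Units (CX X)"
    using rank unfolding weakly_infinite_real_rank_def by blast
  obtain y where y: "\<And>i. continuous_map X euclideanreal (y i)"
    and y'_eq: "y' = (\<lambda>i. of_real_CX X (y i))"
    using self_adjoint_CX_seq[of y' X] y'(1) by blast
  have "unessential_tuple (CX X) K D y'"
    unfolding y'_eq using D y sum_of_squares_of_real_CX_in_Units_iff[of D X y]
    by (intro unessential_tuple_CX[OF X K]) (auto simp: y'_eq)
  then show "\<exists>y. (\<forall>i. y i \<in> self_adjoint (CX X)) \<and>
        unessential_sequence (CX X) K y \<and>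
        (\<forall>i. cnorm (CX X) (x i \<ominus>\<^bsub>CX X\<^esub> y i) < \<epsilon>)"
    unfolding unessential_sequence_def using y' D(1) by blast
qed

section \<open>Weak infinite-dimensionality\<close>

text \<open>The two open sides are the sets where \<open>y\<close> is negative and where it is
  positive.\<close>

lemma partition_between_zero_set:
  assumes y: "continuous_map X euclideanreal y"
    and "F \<subseteq> topspace X" "\<And>p. p \<in> F \<Longrightarrow> y p < 0"
    and "H \<subseteq> topspace X" "\<And>p. p \<in> H \<Longrightarrow> 0 < y p"
  shows "partition_between X F H {p \<in> topspace X. y p = 0}"
proof -
  have "openin X {p \<in> topspace X. y p \<in> {..<0}}" "openin X {p \<in> topspace X. y p \<in> {0<..}}"
    by (rule openin_continuous_map_preimage[OF y]; simp)+
  moreover have "closedin X {p \<in> topspace X. y p \<in> {0}}"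
    by (rule closedin_continuous_map_preimage[OF y]) simp
  ultimately show ?thesis
    unfolding partition_between_def using assms
    by (intro conjI exI[of _ "{p \<in> topspace X. y p < 0}"] exI[of _ "{p \<in> topspace X. 0 < y p}"]) auto
qed

text \<open>Urysohn's lemma with values -1 and 1: the sign tells the two sets apart, and the bound 1
  controls perturbations built from \<open>g\<close>.\<close>

lemma separating_function:
  assumes "normal_space X" "closedin X F" "closedin X H" "F \<inter> H = {}"
  obtains g where "continuous_map X euclideanreal g" "\<And>p. p \<in> topspace X \<Longrightarrow> \<bar>g p\<bar> \<le> 1"
    "\<And>p. p \<in> F \<Longrightarrow> g p = - 1" "\<And>p. p \<in> H \<Longrightarrow> g p = 1"
proof -
  obtain g where "continuous_map X (top_of_set {-1..1::real}) g" "g ` F \<subseteq> {-1}" "g ` H \<subseteq> {1}"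
    using Urysohn_lemma[of X F H "-1" 1] assms by (auto simp: disjnt_def)
  then show ?thesis
    by (intro that[of g]) (auto simp: continuous_map_in_subtopology abs_le_iff image_subset_iff)
qed

lemma real_rank_imp_weakly_infinite_dimensional:
  assumes X: "compact_space X" "normal_space X" and rank: "weakly_infinite_real_rank (CX X)"
  shows "weakly_infinite_dimensional X"
  unfolding weakly_infinite_dimensional_def
proof (intro allI impI)
  fix F H :: "nat \<Rightarrow> 'a set"
  assume FH: "\<forall>i. closedin X (F i) \<and> closedin X (H i) \<and> F i \<inter> H i = {}"
  have "\<exists>g. continuous_map X euclideanreal g \<and> (\<forall>p\<in>F i. g p = - 1) \<and> (\<forall>p\<in>H i. g p = 1)" for i
    using FH separating_function[OF X(2), of "F i" "H i"] by metis
  then obtain x where x: "\<And>i. continuous_map X euclideanreal (x i)"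
      "\<And>i p. p \<in> F i \<Longrightarrow> x i p = - 1" "\<And>i p. p \<in> H i \<Longrightarrow> x i p = 1"
    by metis
  \<comment> \<open>Moving by at most 1/2 cannot change the sign of \<open>x i\<close> where it
    equals -1 or 1.\<close>
  obtain y D where y: "\<And>i. continuous_map X euclideanreal (y i)"
      "\<And>i p. p \<in> topspace X \<Longrightarrow> \<bar>x i p - y i p\<bar> \<le> 1 / 2"
    and D: "\<And>p. p \<in> topspace X \<Longrightarrow> \<exists>i\<in>D. y i p \<noteq> 0"
    using rank[unfolded weakly_infinite_real_rank_CX_iff[OF X(1)], rule_format, of x "1 / 2"] x(1)
    by (metis half_gt_zero zero_less_one)
  have sub: "F i \<subseteq> topspace X" "H i \<subseteq> topspace X" for i
    using FH closedin_subset by blast+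
  have "y i p < 0" if "p \<in> F i" for i p
    using y(2)[of p i] x(2)[OF that] subsetD[OF sub(1) that] by linarith
  moreover have "0 < y i p" if "p \<in> H i" for i p
    using y(2)[of p i] x(3)[OF that] subsetD[OF sub(2) that] by linarith
  ultimately have "partition_between X (F i) (H i) {p \<in> topspace X. y i p = 0}" for i
    using y(1) sub by (intro partition_between_zero_set) auto
  \<comment> \<open>The zero sets with index in \<open>D\<close> alone already have empty
    intersection.\<close>
  moreover have "(\<Inter>i. {p \<in> topspace X. y i p = 0}) = {}"
    using D by fastforce
  ultimately show "\<exists>L. (\<forall>i. partition_between X (F i) (H i) (L i)) \<and> (\<Inter>i. L i) = {}"
    by (intro exI[of _ "\<lambda>i. {p \<in> topspace X. y i p = 0}"]) auto
qed

text \<open>Regularity gives each point an open neighbourhood \<open>G p\<close> with a closed set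
  \<open>B p\<close> between it and some \<open>W i\<close>. Compactness leaves finitely many
  points, and collecting the sets \<open>B p\<close> by index gives the shrinking.\<close>

lemma finite_closed_shrinking:
  assumes X: "compact_space X" "regular_space X"
    and W: "\<And>i. openin X (W i)" and cover: "topspace X \<subseteq> (\<Union>i. W i)"
  obtains C D where "finite D" "\<And>i. closedin X (C i)" "\<And>i. C i \<subseteq> W i"
    "topspace X \<subseteq> (\<Union>i\<in>D. C i)"
proof -
  have "\<exists>i G B. openin X G \<and> closedin X B \<and> p \<in> G \<and> G \<subseteq> B \<and> B \<subseteq> W i" if "p \<in> topspace X" for p
  proof -
    obtain i where "p \<in> W i" using cover \<open>p \<in> topspace X\<close> by blast
    then show ?thesis
      using X(2) W[of i] unfolding neighbourhood_base_of_closedin[symmetric] neighbourhood_base_of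
      by metis
  qed
  then obtain i G B where nb: "\<And>p. p \<in> topspace X \<Longrightarrow>
      openin X (G p) \<and> closedin X (B p) \<and> p \<in> G p \<and> G p \<subseteq> B p \<and> B p \<subseteq> W (i p)"
    by metis
  obtain \<F> where \<F>: "finite \<F>" "\<F> \<subseteq> G ` topspace X" "topspace X \<subseteq> \<Union>\<F>"
    using X(1)[unfolded compact_space_alt, rule_format, of "G ` topspace X"] nb by blast
  obtain P where P: "finite P" "P \<subseteq> topspace X" "\<F> = G ` P"
    using finite_subset_image[OF \<F>(1,2)] by blast
  show ?thesis
  proof (rule that[of "i ` P" "\<lambda>j. \<Union>p\<in>{p\<in>P. i p = j}. B p"])
    show "closedin X (\<Union>p\<in>{p\<in>P. i p = j}. B p)" for j
      using P nb by (intro closedin_Union) auto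
    show "topspace X \<subseteq> (\<Union>j\<in>i ` P. \<Union>p\<in>{p\<in>P. i p = j}. B p)"
    proof
      fix q assume "q \<in> topspace X"
      then obtain p where p: "p \<in> P" "q \<in> G p" using \<F>(3) P(3) by blast
      then have "q \<in> B p" using nb P(2) by blast
      then show "q \<in> (\<Union>j\<in>i ` P. \<Union>p\<in>{p\<in>P. i p = j}. B p)" using p(1) by blast
    qed
  qed (use P nb in auto)
qed

text \<open>Partitions are taken between the sets where \<open>x i\<close> is at most
  \<open>-e\<close> and at least \<open>e\<close>. The modified \<open>y i\<close> has no zero on
  \<open>C i\<close>, and the sets \<open>C i\<close> with \<open>i\<close> in \<open>D\<close>
  cover the space.\<close>

lemma weakly_infinite_dimensional_imp_real_rank:
  assumes X: "compact_space X" "Hausdorff_space X" and dim: "weakly_infinite_dimensional X"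
  shows "weakly_infinite_real_rank (CX X)"
  unfolding weakly_infinite_real_rank_CX_iff[OF X(1)]
proof (intro allI impI, elim conjE)
  fix x :: "nat \<Rightarrow> 'a \<Rightarrow> real" and \<epsilon> :: real
  assume x: "\<forall>i. continuous_map X euclideanreal (x i)" and \<epsilon>: "0 < \<epsilon>"
  have normal: "normal_space X" and regular: "regular_space X"
    using X by (auto intro: compact_Hausdorff_or_regular_imp_normal_space
        compact_Hausdorff_imp_regular_space)
  \<comment> \<open>The modification removes a term of size at most \<open>e\<close> and adds
    another one, so each may use half of \<epsilon>.\<close>
  define e where "e = \<epsilon> / 2"
  have e: "0 < e" using \<epsilon> by (simp add: e_def)
  define F where "F i = {p \<in> topspace X. x i p \<in> {..-e}}" for i
  define H where "H i = {p \<in> topspace X. x i p \<in> {e..}}" for i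
  have FH: "closedin X (F i)" "closedin X (H i)" for i
    unfolding F_def H_def using x by (intro closedin_continuous_map_preimage[of X euclideanreal]; simp)+
  moreover have "F i \<inter> H i = {}" for i
    using e by (auto simp: F_def H_def)
  ultimately obtain L where L: "\<And>i. partition_between X (F i) (H i) (L i)" "(\<Inter>i. L i) = {}"
    using dim unfolding weakly_infinite_dimensional_def by metis
  then obtain U V where UV: "\<And>i. openin X (U i)" "\<And>i. openin X (V i)" "\<And>i. U i \<inter> V i = {}"
      "\<And>i. topspace X - L i = U i \<union> V i" "\<And>i. F i \<subseteq> U i" "\<And>i. H i \<subseteq> V i"
    unfolding partition_between_def by metis
  have cover: "topspace X \<subseteq> (\<Union>i. U i \<union> V i)"
    using L(2) unfolding UV(4)[symmetric] by blast
  obtain C D where D: "finite D" and C: "\<And>i. closedin X (C i)" "\<And>i. C i \<subseteq> U i \<union> V i"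
      "topspace X \<subseteq> (\<Union>i\<in>D. C i)"
    using finite_closed_shrinking[OF X(1) regular openin_Un[OF UV(1,2)] cover] by metis
  \<comment> \<open>Although \<open>U i\<close> and \<open>V i\<close> are open, their traces on
    \<open>C i\<close> are closed: each is \<open>C i\<close> minus the other open set.\<close>
  have CUV: "C i \<inter> U i = C i - V i" "C i \<inter> V i = C i - U i" for i
    using C(2)[of i] UV(3)[of i] by auto
  have "\<exists>s. continuous_map X euclideanreal s \<and> (\<forall>p\<in>topspace X. \<bar>s p\<bar> \<le> 1) \<and>
      (\<forall>p\<in>C i \<inter> U i \<union> F i. s p = - 1) \<and> (\<forall>p\<in>C i \<inter> V i \<union> H i. s p = 1)" for i
  proof -
    have "closedin X (C i \<inter> U i \<union> F i)" "closedin X (C i \<inter> V i \<union> H i)"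
      unfolding CUV using C(1) UV(1,2) FH by (auto intro!: closedin_Un closedin_diff)
    from separating_function[OF normal this] obtain g where "continuous_map X euclideanreal g"
        "\<And>p. p \<in> topspace X \<Longrightarrow> \<bar>g p\<bar> \<le> 1"
        "\<And>p. p \<in> C i \<inter> U i \<union> F i \<Longrightarrow> g p = - 1" "\<And>p. p \<in> C i \<inter> V i \<union> H i \<Longrightarrow> g p = 1"
      using UV(3,5,6)[of i] by blast
    then show ?thesis by blast
  qed
  then obtain s where s: "\<And>i. continuous_map X euclideanreal (s i)"
      "\<And>i p. p \<in> topspace X \<Longrightarrow> \<bar>s i p\<bar> \<le> 1"
      "\<And>i p. p \<in> C i \<inter> U i \<union> F i \<Longrightarrow> s i p = - 1"
      "\<And>i p. p \<in> C i \<inter> V i \<union> H i \<Longrightarrow> s i p = 1"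
    by metis
  \<comment> \<open>Subtracting the truncation of \<open>x i\<close> to \<open>[-e, e]\<close>
    leaves its excess beyond that interval; \<open>e * s i p\<close> then replaces the small
    values.\<close>
  define y where "y i p = x i p - max (- e) (min e (x i p)) + e * s i p" for i p
  have y_cont: "continuous_map X euclideanreal (y i)" for i
    unfolding y_def using x s(1)
    by (intro continuous_map_add continuous_map_diff continuous_map_real_max
        continuous_map_real_min continuous_map_real_mult) auto
  have diff: "\<bar>x i p - y i p\<bar> \<le> \<epsilon>" if "p \<in> topspace X" for i p
  proof -
    have "\<bar>e * s i p\<bar> \<le> e" using s(2)[OF that, of i] e by (simp add: abs_mult)
    moreover have "\<bar>max (- e) (min e (x i p))\<bar> \<le> e" using e by auto
    ultimately show ?thesis unfolding y_def using e_def by linarith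
  qed
  have nz: "\<exists>i\<in>D. y i p \<noteq> 0" if p: "p \<in> topspace X" for p
  proof -
    obtain i where i: "i \<in> D" "p \<in> C i" using C(3) p by blast
    \<comment> \<open>On the \<open>U i\<close> side \<open>x i p < e\<close>, so the excess is at
      most 0 while \<open>e * s i p = - e\<close>; hence \<open>y i p < 0\<close>. The
      \<open>V i\<close> side is symmetric.\<close>
    then consider "p \<in> C i \<inter> U i" "p \<notin> H i" | "p \<in> C i \<inter> V i" "p \<notin> F i"
      using C(2)[of i] UV(3,5,6)[of i] by blast
    then have "y i p \<noteq> 0"
    proof cases
      case 1
      then have "x i p < e" "s i p = - 1" using p s(3) by (auto simp: H_def)
      then show ?thesis using e by (simp add: y_def max_def min_def)
    next
      case 2
      then have "- e < x i p" "s i p = 1" using p s(4) by (auto simp: F_def)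
      then show ?thesis using e by (simp add: y_def max_def min_def)
    qed
    then show ?thesis using i(1) by blast
  qed
  show "\<exists>y D. (\<forall>i. continuous_map X euclideanreal (y i)) \<and>
       (\<forall>i. \<forall>p\<in>topspace X. \<bar>x i p - y i p\<bar> \<le> \<epsilon>) \<and>
       finite D \<and> (\<forall>p\<in>topspace X. \<exists>i\<in>D. y i p \<noteq> 0)"
    using y_cont diff D nz by blast
qed

theorem theorem2p9:
  fixes X :: "'a topology" and K :: real
  assumes "compact_space X" and "Hausdorff_space X" and "0 < K" and "K \<le> 1"
  shows "(weakly_infinite_bounded_rank (CX X) K \<longleftrightarrow> weakly_infinite_real_rank (CX X)) \<and>
         (weakly_infinite_real_rank (CX X) \<longleftrightarrow> weakly_infinite_dimensional X)"
  using bounded_rank_imp_real_rank[OF unital_cstar_algebra_CX[OF assms(1)]]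
    real_rank_imp_bounded_rank_CX[OF assms(1,3,4)]
    real_rank_imp_weakly_infinite_dimensional[OF assms(1)]
    weakly_infinite_dimensional_imp_real_rank[OF assms(1,2)]
    compact_Hausdorff_or_regular_imp_normal_space[OF assms(1)] assms(2)
  by blast

end
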